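(* Let $n$ be a positive integer. The $q\times p$ matrix $R_n(z)=(R_{i,j,n}(z))_{0\leq i\leq q-1,\,0\leq j\leq p-1}$ has the expansion $$R_{n}(z)=(\tau_{\rho,0}\circ\tau_{\rho,1}\circ\cdots\circ\tau_{\rho,n-1})(X_{n}(z)),$$ where $X_n(z)$ is the $q\times p$ matrix with entries on the main diagonal equal to $1/z$, and zero entries elsewhere. More graphically, $$R_n(z)=\cfrac{\mathbf{1}}{\rho_{0}(z)+\rho_{0}^{+}\cfrac{\mathbf{1}}{\rho_{1}(z)+\rho_{1}^{+}\cfrac{\mathbf{1}}{\ddots\rho_{n-2}(z)+\rho_{n-2}^{+}\cfrac{\mathbf{1}}{\rho_{n-1}(z)+\rho_{n-1}^{+}X_{n}(z)\rho_{n-1}^{-}}\,\rho_{n-2}^{-}}\,\rho_{1}^{-}}\,\rho_{0}^{-}}.$$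
   Context: Fix integers $p,q\geq 1$ and, for each $-p\leq k\leq q$, a bi-infinite sequence $(a^{(k)}_{n})_{n\in\mathbb{Z}}$ of complex numbers. Let $H_n=(h_{i,j})_{i,j=0}^{n-1}$ be the $n\times n$ matrix with $h_{i,j}=a^{(j-i)}_{\min(i,j)}$ if $-p\leq j-i\leq q$ and $h_{i,j}=0$ otherwise. For $0\leq i,j\leq n-1$, $R_{i,j,n}(z)$ is the $(i,j)$-entry of $(zI_n-H_n)^{-1}$ (a rational function, equivalently the series $\sum_{\ell\geq 0}(H_n^\ell)_{i,j}z^{-\ell-1}$). If $n<\max(p,q)$, the matrix $R_n(z)$ also involves indices with $i\geq n$ or $j\geq n$; for these, $R_{i,j,n}(z)$ is understood as the $(i,j)$-entry of $(zI-\widetilde H)^{-1}$, where $\widetilde H=(\widetilde h_{i,j})_{i,j=0}^{\infty}$ is the infinite matrix whose principal $n\times n$ truncation is $H_n$ and whose other entries are all zero; that is, $R_{i,j,n}(z)=1/z$ if $i=j\geq n$, and $R_{i,j,n}(z)=0$ if $i\neq j$ and $\max(i,j)\geq n$. (For $0\leq i,j\leq n-1$ the $(i,j)$-entry of $(zI-\widetilde H)^{-1}$ is the one already defined.) Pseudo-quotient. For a $q\times p$ matrix $A=(a_{i,j})_{0\leq i\leq q-1,\,0\leq j\leq p-1}$ over a field (here the field $\mathbb{C}((z^{-1}))$ of formal Laurent series with finitely many positive powers of $z$, which contains the rational functions) with $a_{0,0}\neq 0$, let $T(A)=B=(b_{i,j})$ be the $q\times p$ matrix with $$b_{i,j}=\frac{a_{i+1,j+1}a_{0,0}-a_{0,j+1}a_{i+1,0}}{a_{0,0}}\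 (0\leq i\leq q-2,\ 0\leq j\leq p-2),\quad b_{q-1,j}=-\frac{a_{0,j+1}}{a_{0,0}}\ (0\leq j\leq p-2),$$ $$b_{i,p-1}=\frac{a_{i+1,0}}{a_{0,0}}\ (0\leq i\leq q-2),\qquad b_{q-1,p-1}=\frac{1}{a_{0,0}}.$$ $T$ is a bijection from matrices with $a_{0,0}\neq 0$ onto matrices with $b_{q-1,p-1}\neq 0$; write $A=\frac{\mathbf 1}{B}$ if $B=T(A)$. Coefficients. For $0\leq k\leq n-1$: $\rho_k(z)$ is the $q\times p$ matrix whose only nonzero entry is $z-a_k^{(0)}$ in the bottom right corner. $\rho_k^+$ is the $q\times q$ matrix equal to the identity except that its last row is $(-b_k^{(1)},\ldots,-b_k^{(q)})$, where for $0\leq k\leq n-q-1$ one sets $b_k^{(i)}=a_k^{(i)}$ for $1\leq i\leq q$, and for $n-q\leq k\leq n-1$ one sets $b_k^{(i)}=a_k^{(i)}$ for $1\leq i\leq n-k-1$ and $b_k^{(i)}=0$ for $n-k\leq i\leq q$. $\rho_k^-$ is the $p\times p$ matrix equal to the identity except that its last column is $(b_k^{(-1)},\ldots,b_k^{(-p)})^t$, where for $0\leq k\leq n-p-1$ one sets $b_k^{(-j)}=a_k^{(-j)}$ for $1\leq j\leq p$, and for $n-p\leq k\leq n-1$ one sets $b_k^{(-j)}=a_k^{(-j)}$ for $1\leq j\leq n-k-1$ and $b_k^{(-j)}=0$ for $n-k\leq j\leq p$. For $q\times p$ matrices $X$, $$\tau_{\rho,k}(X)=\frac{\mathbf 1}{\rho_k(z)+\rho_k^+X\rho_k^-},\qquad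 0\leq k\leq n-1.$$ *)

theory Defs
  imports
    "Jordan_Normal_Form.Gauss_Jordan_Elimination"
    "HOL-Computational_Algebra.Formal_Laurent_Series"
begin

text \<open>
  The field of formal Laurent series in \<open>1/z\<close> with finitely many positive powers of \<open>z\<close> is the
  type \<^typ>\<open>complex fls\<close>, read with \<^term>\<open>fls_X\<close> as \<open>1/z\<close>.
\<close>

definition z_var :: "complex fls" where
  "z_var = fls_X_inv"

text \<open>
  Throughout, \<open>a k n\<close> is the entry with (lower) index \<open>n\<close> of the sequence with superscript \<open>k\<close>;
  only superscripts \<open>k\<close> between \<open>- p\<close> and \<open>q\<close> are ever used.
\<close>

definition H_mat :: "nat \<Rightarrow> nat \<Rightarrow> (int \<Rightarrow> int \<Rightarrow> complex) \<Rightarrow> nat \<Rightarrow> complex mat" where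
  "H_mat p q a n = mat n n (\<lambda>(i, j).
     if - int p \<le> int j - int i \<and> int j - int i \<le> int q
     then a (int j - int i) (int (min i j)) else 0)"

definition resolvent_H :: "nat \<Rightarrow> nat \<Rightarrow> (int \<Rightarrow> int \<Rightarrow> complex) \<Rightarrow> nat \<Rightarrow> complex fls mat" where
  "resolvent_H p q a n =
     the (mat_inverse (z_var \<cdot>\<^sub>m 1\<^sub>m n - map_mat fls_const (H_mat p q a n)))"

text \<open>
  For an index outside the \<open>n \<times> n\<close> block, this is the entry of the inverse of \<open>z I - H'\<close>, where
  \<open>H'\<close> is the infinite matrix obtained from \<open>H_mat p q a n\<close> by padding with zeros.
\<close>

definition R_entry ::
  "nat \<Rightarrow> nat \<Rightarrow> (int \<Rightarrow> int \<Rightarrow> complex) \<Rightarrow> nat \<Rightarrow> nat \<Rightarrow> nat \<Rightarrow> complex fls" where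
  "R_entry p q a n i j =
     (if i < n \<and> j < n then resolvent_H p q a n $$ (i, j)
      else if i = j then 1 / z_var else 0)"

definition R_mat :: "nat \<Rightarrow> nat \<Rightarrow> (int \<Rightarrow> int \<Rightarrow> complex) \<Rightarrow> nat \<Rightarrow> complex fls mat" where
  "R_mat p q a n = mat q p (\<lambda>(i, j). R_entry p q a n i j)"

definition pq_T :: "'a :: field mat \<Rightarrow> 'a mat" where
  "pq_T A = (let q = dim_row A; p = dim_col A in mat q p (\<lambda>(i, j).
     if i + 1 < q then
       (if j + 1 < p
        then (A $$ (i + 1, j + 1) * A $$ (0, 0) - A $$ (0, j + 1) * A $$ (i + 1, 0)) / A $$ (0, 0)
        else A $$ (i + 1, 0) / A $$ (0, 0))
     else
       (if j + 1 < p then - (A $$ (0, j + 1) / A $$ (0, 0)) else 1 / A $$ (0, 0))))"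

text \<open>
  The pseudo-quotient \<open>\<one>/B\<close>: the preimage of \<open>B\<close> under the bijection \<^const>\<open>pq_T\<close> from the matrices
  with nonzero top left entry onto those with nonzero bottom right entry. It is unspecified when
  the bottom right entry of \<open>B\<close> is zero.
\<close>

definition pseudo_recip :: "'a :: field mat \<Rightarrow> 'a mat" where
  "pseudo_recip B = (THE A. A \<in> carrier_mat (dim_row B) (dim_col B) \<and>
     A $$ (0, 0) \<noteq> 0 \<and> pq_T A = B)"

definition rho :: "nat \<Rightarrow> nat \<Rightarrow> (int \<Rightarrow> int \<Rightarrow> complex) \<Rightarrow> nat \<Rightarrow> complex fls mat" where
  "rho p q a k = mat q p (\<lambda>(i, j).
     if i + 1 = q \<and> j + 1 = p then z_var - fls_const (a 0 (int k)) else 0)"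

text \<open>
  The truncated coefficients, with \<open>1 \<le> i \<le> q\<close> in \<open>b_plus\<close> and \<open>1 \<le> j \<le> p\<close> in \<open>b_minus\<close>: the
  condition \<open>k + i < n\<close> (that is, \<open>i \<le> n - k - 1\<close>) is automatic when \<open>k \<le> n - q - 1\<close>, and likewise
  for \<open>j\<close> and \<open>p\<close>.
\<close>

definition b_plus :: "(int \<Rightarrow> int \<Rightarrow> complex) \<Rightarrow> nat \<Rightarrow> nat \<Rightarrow> nat \<Rightarrow> complex" where
  "b_plus a n k i = (if k + i < n then a (int i) (int k) else 0)"

definition b_minus :: "(int \<Rightarrow> int \<Rightarrow> complex) \<Rightarrow> nat \<Rightarrow> nat \<Rightarrow> nat \<Rightarrow> complex" where
  "b_minus a n k j = (if k + j < n then a (- int j) (int k) else 0)"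

definition rho_plus :: "nat \<Rightarrow> (int \<Rightarrow> int \<Rightarrow> complex) \<Rightarrow> nat \<Rightarrow> nat \<Rightarrow> complex fls mat" where
  "rho_plus q a n k = mat q q (\<lambda>(i, j).
     if i + 1 = q then - fls_const (b_plus a n k (j + 1)) else if i = j then 1 else 0)"

definition rho_minus :: "nat \<Rightarrow> (int \<Rightarrow> int \<Rightarrow> complex) \<Rightarrow> nat \<Rightarrow> nat \<Rightarrow> complex fls mat" where
  "rho_minus p a n k = mat p p (\<lambda>(i, j).
     if j + 1 = p then fls_const (b_minus a n k (i + 1)) else if i = j then 1 else 0)"

definition tau_denom ::
  "nat \<Rightarrow> nat \<Rightarrow> (int \<Rightarrow> int \<Rightarrow> complex) \<Rightarrow> nat \<Rightarrow> nat \<Rightarrow> complex fls mat \<Rightarrow> complex fls mat" where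
  "tau_denom p q a n k X = rho p q a k + rho_plus q a n k * X * rho_minus p a n k"

definition tau_rho ::
  "nat \<Rightarrow> nat \<Rightarrow> (int \<Rightarrow> int \<Rightarrow> complex) \<Rightarrow> nat \<Rightarrow> nat \<Rightarrow> complex fls mat \<Rightarrow> complex fls mat" where
  "tau_rho p q a n k X = pseudo_recip (tau_denom p q a n k X)"

definition X_mat :: "nat \<Rightarrow> nat \<Rightarrow> complex fls mat" where
  "X_mat p q = mat q p (\<lambda>(i, j). if i = j then 1 / z_var else 0)"

text \<open>
  The composition of \<open>tau_rho p q a n k\<close>, \<open>tau_rho p q a n (k + 1)\<close>, \<dots>, \<open>tau_rho p q a n (n - 1)\<close>
  applied to \<open>X\<close> (the last map acts first); it is \<open>X\<close> for \<open>k = n\<close>.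
\<close>

definition tau_tail ::
  "nat \<Rightarrow> nat \<Rightarrow> (int \<Rightarrow> int \<Rightarrow> complex) \<Rightarrow> nat \<Rightarrow> nat \<Rightarrow> complex fls mat \<Rightarrow> complex fls mat" where
  "tau_tail p q a n k X = foldr (tau_rho p q a n) [k..<n] X"

end

theory Submission
  imports Defs "Jordan_Normal_Form.Determinant"
begin

text \<open>
  Write \<open>z I - H\<close> as a bordered matrix whose lower right block is \<open>z I - H'\<close>, where \<open>H'\<close> is built from
  the sequences shifted by one. The Schur complement formulas for the inverse of a bordered matrix,
  restricted to the first \<open>q\<close> rows and \<open>p\<close> columns, say exactly that \<^const>\<open>pq_T\<close> of \<open>R\<^sub>n\<close> is
  \<open>\<rho>\<^sub>0 + \<rho>\<^sub>0\<^sup>+ R' \<rho>\<^sub>0\<^sup>-\<close>, with \<open>R'\<close> the matrix of size \<open>n - 1\<close> of the shifted sequences; the matrix of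
  size \<open>0\<close> is \<open>X\<close>. Padding \<open>H\<close> with zeros to a size of at least \<open>n\<close>, \<open>p\<close> and \<open>q\<close> makes the argument
  uniform in \<open>n\<close>.
\<close>

section \<open>Inverses of bordered matrices\<close>

text \<open>Matrices are functions on all indices, cut off at \<open>N\<close>: one function serves
  every size, and deleting the first row and column is composition with \<open>Suc\<close>.\<close>

definition inverse_upto ::
  "nat \<Rightarrow> (nat \<Rightarrow> nat \<Rightarrow> 'a :: comm_ring_1) \<Rightarrow> (nat \<Rightarrow> nat \<Rightarrow> 'a) \<Rightarrow> bool" where
  "inverse_upto N M W \<longleftrightarrow>
     (\<forall>i<N. \<forall>j<N. (\<Sum>k<N. M i k * W k j) = of_bool (i = j)) \<and>
     (\<forall>i<N. \<forall>j<N. (\<Sum>k<N. W i k * M k j) = of_bool (i = j))"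

lemma inverse_upto_right:
  "inverse_upto N M W \<Longrightarrow> i < N \<Longrightarrow> j < N \<Longrightarrow> (\<Sum>k<N. M i k * W k j) = of_bool (i = j)"
  by (simp add: inverse_upto_def)

lemma inverse_upto_transpose:
  "inverse_upto N M W \<Longrightarrow> inverse_upto N (\<lambda>i j. M j i) (\<lambda>i j. W j i)"
  by (auto simp: inverse_upto_def mult.commute)

text \<open>Multiply the system by \<open>W\<close> from the left and exchange the sums.\<close>

lemma inverse_upto_solve:
  assumes "inverse_upto N M W" and "\<And>i. i < N \<Longrightarrow> (\<Sum>k<N. M i k * x k) = f i" and "i < N"
  shows "x i = (\<Sum>j<N. W i j * f j)"
proof -
  have "(\<Sum>j<N. W i j * f j) = (\<Sum>j<N. W i j * (\<Sum>k<N. M j k * x k))"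
    using assms(2) by (intro sum.cong) auto
  also have "\<dots> = (\<Sum>k<N. (\<Sum>j<N. W i j * M j k) * x k)"
    unfolding sum_distrib_left sum_distrib_right by (subst sum.swap) (simp add: mult.assoc)
  also have "\<dots> = (\<Sum>k<N. of_bool (i = k) * x k)"
    using assms(1,3) by (intro sum.cong) (auto simp: inverse_upto_def)
  also have "\<dots> = x i"
    using assms(3) by (subst sum.remove[of _ i]) auto
  finally show ?thesis by simp
qed

context
  fixes N :: nat and M W S :: "nat \<Rightarrow> nat \<Rightarrow> 'a :: field"
  assumes W: "inverse_upto (Suc N) M W"
    and S: "inverse_upto N (\<lambda>i j. M (Suc i) (Suc j)) S"
begin

text \<open>Below the first row, column \<open>0\<close> of \<open>M W = 1\<close> is a linear
  system for the entries \<open>W (Suc i) 0\<close> whose matrix is the lower right block;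
  \<open>S\<close> solves it.\<close>

lemma bordered_inverse_column:
  assumes "i < N"
  shows "W (Suc i) 0 = - (W 0 0 * (\<Sum>j<N. S i j * M (Suc j) 0))"
proof -
  have eq: "(\<Sum>k<N. M (Suc i) (Suc k) * W (Suc k) 0) = - (M (Suc i) 0 * W 0 0)" if "i < N" for i
    using inverse_upto_right[OF W, of "Suc i" 0] that
    by (simp add: sum.lessThan_Suc_shift add_eq_0_iff del: sum.lessThan_Suc)
  show ?thesis
    using inverse_upto_solve[OF S, of "\<lambda>i. W (Suc i) 0", OF eq assms]
    by (simp add: sum_distrib_left sum_negf algebra_simps)
qed

text \<open>Row \<open>0\<close> of the same column, after substitution: \<open>W 0 0\<close> is the
  reciprocal of the Schur complement.\<close>

lemma bordered_inverse_corner: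
  "W 0 0 * (M 0 0 - (\<Sum>i<N. M 0 (Suc i) * (\<Sum>j<N. S i j * M (Suc j) 0))) = 1"
proof -
  have "1 = M 0 0 * W 0 0 + (\<Sum>k<N. M 0 (Suc k) * W (Suc k) 0)"
    using inverse_upto_right[OF W, of 0 0]
    by (simp add: sum.lessThan_Suc_shift del: sum.lessThan_Suc)
  also have "(\<Sum>k<N. M 0 (Suc k) * W (Suc k) 0) =
      - (W 0 0 * (\<Sum>k<N. M 0 (Suc k) * (\<Sum>j<N. S k j * M (Suc j) 0)))"
    by (simp add: bordered_inverse_column sum_distrib_left sum_negf algebra_simps)
  finally show ?thesis
    by (simp add: algebra_simps)
qed

text \<open>The same argument for column \<open>Suc j\<close>. The entry \<open>W 0 (Suc j)\<close>
  stays unexpanded, which suits the numerator in \<open>pq_T\<close>.\<close>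

lemma bordered_inverse_block:
  assumes "i < N" "j < N"
  shows "W (Suc i) (Suc j) = S i j - W 0 (Suc j) * (\<Sum>k<N. S i k * M (Suc k) 0)"
proof -
  have eq: "(\<Sum>k<N. M (Suc i) (Suc k) * W (Suc k) (Suc j)) =
      of_bool (i = j) - M (Suc i) 0 * W 0 (Suc j)" if "i < N" for i
    using inverse_upto_right[OF W, of "Suc i" "Suc j"] that assms(2)
    by (simp add: sum.lessThan_Suc_shift eq_diff_eq add.commute del: sum.lessThan_Suc)
  have "W (Suc i) (Suc j) =
      (\<Sum>k<N. S i k * of_bool (k = j)) - W 0 (Suc j) * (\<Sum>k<N. S i k * M (Suc k) 0)"
    using inverse_upto_solve[OF S, of "\<lambda>i. W (Suc i) (Suc j)", OF eq assms(1)]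
    by (simp add: sum_distrib_left sum_subtractf algebra_simps)
  also have "(\<Sum>k<N. S i k * of_bool (k = j)) = S i j"
    using assms(2) by (subst sum.remove[of _ j]) auto
  finally show ?thesis .
qed

end

text \<open>Transposition exchanges the two one-sided identities, so this is the column formula for
  the transposes.\<close>

lemma bordered_inverse_row:
  fixes M :: "nat \<Rightarrow> nat \<Rightarrow> 'a :: field"
  assumes "inverse_upto (Suc N) M W" and "inverse_upto N (\<lambda>i j. M (Suc i) (Suc j)) S" and "j < N"
  shows "W 0 (Suc j) = - (W 0 0 * (\<Sum>i<N. M 0 (Suc i) * S i j))"
  using bordered_inverse_column[OF inverse_upto_transpose[OF assms(1)]
      inverse_upto_transpose[OF assms(2)] assms(3)]
  by (simp add: mult.commute)

section \<open>The resolvent of a constant matrix\<close>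

text \<open>
  Comparing coefficients, \<open>z x = h x\<close> expresses each coefficient of \<open>x\<close> by coefficients of the next
  lower order, and these vanish eventually.
\<close>

lemma z_var_eigenvector_zero:
  fixes x :: "nat \<Rightarrow> complex fls"
  assumes eq: "\<And>i. i < n \<Longrightarrow> z_var * x i = (\<Sum>j<n. fls_const (h i j) * x j)" and "i < n"
  shows "x i = 0"
proof -
  define N where "N = Min (insert 0 ((\<lambda>i. fls_subdegree (x i)) ` {..<n}))"
  have low: "fls_nth (x i) k = 0" if "i < n" "k < N" for i k
  proof -
    have "N \<le> fls_subdegree (x i)"
      unfolding N_def using that by (intro Min_le) auto
    with that show ?thesis by simp
  qed
  have step: "fls_nth (x i) (k + 1) = (\<Sum>j<n. h i j * fls_nth (x j) k)" if "i < n" for i k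
    using arg_cong[OF eq[OF that], of "\<lambda>f. fls_nth f k"]
    by (simp add: z_var_def fls_X_inv_times_conv_shift fls_nth_sum)
  \<comment> \<open>The induction starts at order \<open>N - 1\<close>, where \<open>low\<close>
    makes all coefficients vanish, and \<open>step\<close> climbs through all higher orders.\<close>
  have "\<forall>i<n. fls_nth (x i) (N - 1 + int m) = 0" for m
  proof (induction m)
    case 0
    then show ?case using low by simp
  next
    case (Suc m)
    have "fls_nth (x i) (N - 1 + int m + 1) = 0" if "i < n" for i
      unfolding step[OF that] using Suc by (intro sum.neutral) auto
    then show ?case by (simp add: add_ac)
  qed
  note vanish = this
  have "fls_nth (x i) k = 0" for k
  proof (cases "k < N")
    case True
    with low \<open>i < n\<close> show ?thesis by simp
  next
    case False
    with vanish[of "nat (k - (N - 1))"] \<open>i < n\<close> show ?thesis by simp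
  qed
  then show ?thesis by (simp add: fls_eq_iff)
qed

text \<open>A kernel vector \<open>v\<close> of \<open>M\<close> satisfies \<open>z v = H v\<close>
  with constant \<open>H\<close>, hence vanishes. So the determinant is nonzero, and
  \<open>mat_inverse\<close> returns an actual inverse for \<open>the\<close> to extract.\<close>

lemma resolvent_H_inverse:
  fixes p q n :: nat and a :: "int \<Rightarrow> int \<Rightarrow> complex"
  defines "M \<equiv> z_var \<cdot>\<^sub>m 1\<^sub>m n - map_mat fls_const (H_mat p q a n)"
  shows "resolvent_H p q a n \<in> carrier_mat n n"
    and "M * resolvent_H p q a n = 1\<^sub>m n"
    and "resolvent_H p q a n * M = 1\<^sub>m n"
proof -
  have M: "M \<in> carrier_mat n n"
    by (auto simp: M_def H_mat_def)
  have "det M \<noteq> 0"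
  proof
    assume "det M = 0"
    then obtain v where v: "v \<in> carrier_vec n" "v \<noteq> 0\<^sub>v n" "M *\<^sub>v v = 0\<^sub>v n"
      using det_0_iff_vec_prod_zero[OF M] by auto
    have "v $ i = 0" if "i < n" for i
    proof (rule z_var_eigenvector_zero[where n = n and h = "\<lambda>i j. H_mat p q a n $$ (i, j)"
          and x = "\<lambda>i. v $ i"])
      fix i assume i: "i < n"
      have "0 = (M *\<^sub>v v) $ i"
        using v i by simp
      also have "\<dots> = (\<Sum>j<n. ((if i = j then z_var else 0) - fls_const (H_mat p q a n $$ (i, j))) * v $ j)"
        using v(1) i by (auto simp: M_def H_mat_def scalar_prod_def atLeast0LessThan intro!: sum.cong)
      also have "\<dots> = (\<Sum>j<n. (if i = j then z_var else 0) * v $ j) -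
          (\<Sum>j<n. fls_const (H_mat p q a n $$ (i, j)) * v $ j)"
        by (simp add: left_diff_distrib sum_subtractf)
      also have "(\<Sum>j<n. (if i = j then z_var else 0) * v $ j) = z_var * v $ i"
        using i by (subst sum.remove[of _ i]) auto
      finally show "z_var * v $ i = (\<Sum>j<n. fls_const (H_mat p q a n $$ (i, j)) * v $ j)"
        by simp
    qed fact
    then have "v = 0\<^sub>v n" using v(1) by auto
    with v(2) show False by simp
  qed
  then have "M \<in> Units (ring_mat TYPE(complex fls) n ())"
    by (rule det_non_zero_imp_unit[OF M])
  then obtain B where "mat_inverse M = Some B"
    using mat_inverse(1)[OF M, where b = "()"] by (cases "mat_inverse M") auto
  moreover from mat_inverse(2)[OF M this]
  have "M * B = 1\<^sub>m n" "B * M = 1\<^sub>m n" "B \<in> carrier_mat n n"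
    by auto
  ultimately show "resolvent_H p q a n \<in> carrier_mat n n"
    and "M * resolvent_H p q a n = 1\<^sub>m n"
    and "resolvent_H p q a n * M = 1\<^sub>m n"
    by (simp_all add: resolvent_H_def flip: M_def)
qed

section \<open>Zero padding to an arbitrary size\<close>

definition padded_H :: "nat \<Rightarrow> nat \<Rightarrow> (int \<Rightarrow> int \<Rightarrow> complex) \<Rightarrow> nat \<Rightarrow> nat \<Rightarrow> nat \<Rightarrow> complex" where
  "padded_H p q a n i j = (if i < n \<and> j < n then H_mat p q a n $$ (i, j) else 0)"

definition padded_pencil ::
  "nat \<Rightarrow> nat \<Rightarrow> (int \<Rightarrow> int \<Rightarrow> complex) \<Rightarrow> nat \<Rightarrow> nat \<Rightarrow> nat \<Rightarrow> complex fls" where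
  "padded_pencil p q a n i j = of_bool (i = j) * z_var - fls_const (padded_H p q a n i j)"

lemma z_var_neq_0: "z_var \<noteq> 0"
  by (simp add: z_var_def)

text \<open>Off the \<open>n\<close> by \<open>n\<close> block both matrices are scalar with
  mutually inverse factors, so the sum for such an entry reduces to one term.\<close>

lemma sum_padded_mult:
  fixes A B :: "nat \<Rightarrow> nat \<Rightarrow> 'a :: field"
  assumes "n \<le> N" "i < N" "j < N"
    and AB: "\<And>i j. i < n \<Longrightarrow> j < n \<Longrightarrow> (\<Sum>k<n. A i k * B k j) = of_bool (i = j)"
    and A: "\<And>i j. n \<le> i \<or> n \<le> j \<Longrightarrow> A i j = (if i = j then c else 0)"
    and B: "\<And>i j. n \<le> i \<or> n \<le> j \<Longrightarrow> B i j = (if i = j then d else 0)"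
    and cd: "c * d = 1"
  shows "(\<Sum>k<N. A i k * B k j) = of_bool (i = j)"
proof (cases "i < n \<and> j < n")
  case True
  have "(\<Sum>k<N. A i k * B k j) = (\<Sum>k<n. A i k * B k j)"
    using assms(1) True by (intro sum.mono_neutral_right) (auto simp: A)
  with True AB show ?thesis by simp
next
  case False
  then consider "n \<le> i" | "n \<le> j" by linarith
  then show ?thesis
  proof cases
    case 1
    with assms(2) show ?thesis
      by (subst sum.remove[of _ i]) (auto simp: A B cd intro!: sum.neutral)
  next
    case 2
    with assms(3) show ?thesis
      by (subst sum.remove[of _ j]) (auto simp: A B cd intro!: sum.neutral)
  qed
qed

text \<open>The value \<open>1 / z_var\<close> prescribed on the diagonal outside the block inverts
  the padded part of the pencil.\<close>

lemma R_entry_inverse: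
  assumes "n \<le> N"
  shows "inverse_upto N (padded_pencil p q a n) (R_entry p q a n)"
proof -
  define M where "M = z_var \<cdot>\<^sub>m 1\<^sub>m n - map_mat fls_const (H_mat p q a n)"
  note R = resolvent_H_inverse[where n = n and p = p and q = q and a = a, folded M_def]
  have M: "M \<in> carrier_mat n n"
    by (auto simp: M_def H_mat_def)
  have M_nth: "padded_pencil p q a n i j = M $$ (i, j)" if "i < n" "j < n" for i j
    using that by (simp add: M_def padded_pencil_def padded_H_def H_mat_def)
  have R_nth: "R_entry p q a n i j = resolvent_H p q a n $$ (i, j)" if "i < n" "j < n" for i j
    using that by (simp add: R_entry_def)
  have 1: "(\<Sum>k<n. padded_pencil p q a n i k * R_entry p q a n k j) = of_bool (i = j)"
    if "i < n" "j < n" for i j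
    using arg_cong[OF R(2), of "\<lambda>A. A $$ (i, j)"] that R(1) M
    by (simp add: scalar_prod_def atLeast0LessThan M_nth R_nth)
  have 2: "(\<Sum>k<n. R_entry p q a n i k * padded_pencil p q a n k j) = of_bool (i = j)"
    if "i < n" "j < n" for i j
    using arg_cong[OF R(3), of "\<lambda>A. A $$ (i, j)"] that R(1) M
    by (simp add: scalar_prod_def atLeast0LessThan M_nth R_nth)
  have pad: "padded_pencil p q a n i j = (if i = j then z_var else 0)"
    "R_entry p q a n i j = (if i = j then 1 / z_var else 0)" if "n \<le> i \<or> n \<le> j" for i j
    using that by (auto simp: padded_pencil_def padded_H_def R_entry_def)
  have c: "z_var * (1 / z_var) = 1" "1 / z_var * z_var = 1"
    using z_var_neq_0 by auto
  show ?thesis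
    unfolding inverse_upto_def
    using sum_padded_mult[OF assms _ _ 1 pad c(1)] sum_padded_mult[OF assms _ _ 2 pad(2,1) c(2)]
    by blast
qed

section \<open>One step of the continued fraction\<close>

definition shift_seq :: "nat \<Rightarrow> (int \<Rightarrow> int \<Rightarrow> complex) \<Rightarrow> int \<Rightarrow> int \<Rightarrow> complex" where
  "shift_seq k a d m = a d (m + int k)"

text \<open>A step down the diagonal keeps \<open>j - i\<close> and raises \<open>min i j\<close> by
  one, which the shift of the lower index absorbs.\<close>

lemma padded_pencil_Suc_Suc:
  "padded_pencil p q a (Suc n) (Suc i) (Suc j) = padded_pencil p q (shift_seq 1 a) n i j"
  by (simp add: padded_pencil_def padded_H_def H_mat_def shift_seq_def add.commute)

lemma padded_pencil_0_0:
  "padded_pencil p q a (Suc n) 0 0 = z_var - fls_const (a 0 0)"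
  by (simp add: padded_pencil_def padded_H_def H_mat_def)

text \<open>Two cutoffs meet in the border: the band ends at \<open>q\<close>, and the padding
  begins where \<open>b_plus\<close> truncates.\<close>

lemma padded_pencil_0_Suc:
  "padded_pencil p q a (Suc n) 0 (Suc j) = (if j < q then - fls_const (b_plus a (Suc n) 0 (j + 1)) else 0)"
  by (auto simp: padded_pencil_def padded_H_def H_mat_def b_plus_def add.commute)

lemma padded_pencil_Suc_0:
  "padded_pencil p q a (Suc n) (Suc i) 0 = (if i < p then - fls_const (b_minus a (Suc n) 0 (i + 1)) else 0)"
  by (auto simp: padded_pencil_def padded_H_def H_mat_def b_minus_def add.commute)

lemma sum_indicator_unit:
  fixes f :: "nat \<Rightarrow> 'a :: comm_ring_1"
  assumes "i < n"
  shows "(\<Sum>k<n. (if i = k then 1 else 0) * f k) = f i" "(\<Sum>k<n. f k * (if k = i then 1 else 0)) = f i"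
  using assms by (auto simp: sum.remove[of "{..<n}" i])

text \<open>Multiplying by \<open>rho_plus\<close> alters only the last row and by
  \<open>rho_minus\<close> only the last column, whence the same four cases as in
  \<open>pq_T\<close>.\<close>

lemma tau_denom_entry:
  assumes "i < q" "j < p"
  shows "tau_denom p q a n k (mat q p (\<lambda>(i, j). X i j)) $$ (i, j) =
    (if i + 1 < q then
       (if j + 1 < p then X i j
        else (\<Sum>l<p. X i l * fls_const (b_minus a n k (l + 1))))
     else
       (if j + 1 < p then - (\<Sum>l<q. fls_const (b_plus a n k (l + 1)) * X l j)
        else z_var - fls_const (a 0 (int k)) -
          (\<Sum>l<q. fls_const (b_plus a n k (l + 1)) *
             (\<Sum>m<p. X l m * fls_const (b_minus a n k (m + 1))))))"
proof -
  \<comment> \<open>\<open>P\<close> is row \<open>i\<close> of \<open>rho_plus\<close>, and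
    \<open>Q\<close> is column \<open>j\<close> of \<open>rho_minus\<close>.\<close>
  define P where "P l = (if i + 1 < q then if i = l then 1 else 0
    else - fls_const (b_plus a n k (l + 1)))" for l
  define Q where "Q l = (if j + 1 < p then if l = j then 1 else 0
    else fls_const (b_minus a n k (l + 1)))" for l
  have P: "(rho_plus q a n k) $$ (i, l) = P l" if "l < q" for l
    using that assms by (auto simp: rho_plus_def P_def)
  have Q: "(rho_minus p a n k) $$ (l, j) = Q l" if "l < p" for l
    using that assms by (auto simp: rho_minus_def Q_def)
  have dims: "rho_plus q a n k \<in> carrier_mat q q" "rho_minus p a n k \<in> carrier_mat p p"
    "rho p q a k \<in> carrier_mat q p"
    by (auto simp: rho_plus_def rho_minus_def rho_def)
  have "(rho_plus q a n k * mat q p (\<lambda>(i, j). X i j) * rho_minus p a n k) $$ (i, j) =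
      (rho_plus q a n k * (mat q p (\<lambda>(i, j). X i j) * rho_minus p a n k)) $$ (i, j)"
    using dims by (subst assoc_mult_mat[of _ q q _ p _ p]) auto
  also have "\<dots> = (\<Sum>l<q. P l * (\<Sum>m<p. X l m * Q m))"
    using dims assms by (simp add: scalar_prod_def atLeast0LessThan P Q)
  finally have prod: "(rho_plus q a n k * mat q p (\<lambda>(i, j). X i j) * rho_minus p a n k) $$ (i, j) =
      (\<Sum>l<q. P l * (\<Sum>m<p. X l m * Q m))" .
  have inner: "(\<Sum>m<p. X l m * Q m) = (if j + 1 < p then X l j
      else (\<Sum>m<p. X l m * fls_const (b_minus a n k (m + 1))))" for l
    using assms unfolding Q_def by (simp add: sum_indicator_unit)
  have "(\<Sum>l<q. P l * Y l) = (if i + 1 < q then Y i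
      else - (\<Sum>l<q. fls_const (b_plus a n k (l + 1)) * Y l))" for Y
    using assms unfolding P_def by (simp add: sum_indicator_unit sum_negf)
  then show ?thesis
    using dims assms unfolding tau_denom_def
    by (auto simp: prod inner rho_def)
qed

text \<open>The bordered inverse formulas, solved for \<open>S i j\<close>, the two border sums and
  \<open>1 / W 0 0\<close>, are the four cases of \<open>pq_T\<close>.\<close>

lemma R_mat_step:
  assumes "p \<ge> 1" and "q \<ge> 1"
  shows "R_mat p q a (Suc n) $$ (0, 0) \<noteq> 0"
    and "pq_T (R_mat p q a (Suc n)) = tau_denom p q a (Suc n) 0 (R_mat p q (shift_seq 1 a) n)"
proof -
  \<comment> \<open>With \<open>p\<close> and \<open>q\<close> below \<open>N\<close>, the whole
    border and all entries of \<open>S\<close> in the first \<open>q\<close> rows and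
    \<open>p\<close> columns fit inside.\<close>
  define N where "N = max n (max p q)"
  define W where "W = R_entry p q a (Suc n)"
  define S where "S = R_entry p q (shift_seq 1 a) n"
  define u where "u l = fls_const (b_plus a (Suc n) 0 (l + 1))" for l
  define v where "v l = fls_const (b_minus a (Suc n) 0 (l + 1))" for l
  let ?M = "padded_pencil p q a (Suc n)"
  have N: "n \<le> N" "p \<le> N" "q \<le> N"
    by (auto simp: N_def)
  have invW: "inverse_upto (Suc N) ?M W"
    unfolding W_def using N by (intro R_entry_inverse) simp
  have invS: "inverse_upto N (\<lambda>i j. ?M (Suc i) (Suc j)) S"
    unfolding S_def padded_pencil_Suc_Suc using N by (intro R_entry_inverse)
  \<comment> \<open>The border row vanishes beyond the band; the sign is that of \<open>H\<close> in
    \<open>z I - H\<close>.\<close>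
  have row: "(\<Sum>l<N. ?M 0 (Suc l) * Y l) = - (\<Sum>l<q. u l * Y l)" for Y
  proof -
    have "(\<Sum>l<N. ?M 0 (Suc l) * Y l) = (\<Sum>l<q. ?M 0 (Suc l) * Y l)"
      using N by (intro sum.mono_neutral_right) (auto simp: padded_pencil_0_Suc)
    then show ?thesis
      by (simp add: padded_pencil_0_Suc u_def sum_negf)
  qed
  have col: "(\<Sum>l<N. Y l * ?M (Suc l) 0) = - (\<Sum>l<p. Y l * v l)" for Y
  proof -
    have "(\<Sum>l<N. Y l * ?M (Suc l) 0) = (\<Sum>l<p. Y l * ?M (Suc l) 0)"
      using N by (intro sum.mono_neutral_right) (auto simp: padded_pencil_Suc_0)
    then show ?thesis
      by (simp add: padded_pencil_Suc_0 v_def sum_negf)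
  qed
  have corner: "W 0 0 * (z_var - fls_const (a 0 0) - (\<Sum>l<q. u l * (\<Sum>m<p. S l m * v m))) = 1"
    using bordered_inverse_corner[OF invW invS]
    by (simp add: row col padded_pencil_0_0 sum_negf)
  then have nz: "W 0 0 \<noteq> 0" by auto
  have W_row: "W 0 (Suc j) = W 0 0 * (\<Sum>l<q. u l * S l j)" if "j < N" for j
    using bordered_inverse_row[OF invW invS that] by (simp add: row)
  have W_col: "W (Suc i) 0 = W 0 0 * (\<Sum>l<p. S i l * v l)" if "i < N" for i
    using bordered_inverse_column[OF invW invS that] by (simp add: col)
  have W_block: "W (Suc i) (Suc j) = S i j + W 0 (Suc j) * (\<Sum>l<p. S i l * v l)"
    if "i < N" "j < N" for i j
    using bordered_inverse_block[OF invW invS that] by (simp add: col)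
  have R_nth: "R_mat p q a (Suc n) $$ (i, j) = W i j" if "i < q" "j < p" for i j
    using that by (simp add: R_mat_def W_def)
  have R_dim: "dim_row (R_mat p q a (Suc n)) = q" "dim_col (R_mat p q a (Suc n)) = p"
    by (auto simp: R_mat_def)
  show "R_mat p q a (Suc n) $$ (0, 0) \<noteq> 0"
    using nz assms by (simp add: R_nth)
  have T: "pq_T (R_mat p q a (Suc n)) $$ (i, j) = (if i + 1 < q then
       (if j + 1 < p then (W (i + 1) (j + 1) * W 0 0 - W 0 (j + 1) * W (i + 1) 0) / W 0 0
        else W (i + 1) 0 / W 0 0)
     else (if j + 1 < p then - (W 0 (j + 1) / W 0 0) else 1 / W 0 0))" if "i < q" "j < p" for i j
    using that assms by (auto simp: pq_T_def R_dim R_nth Let_def)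
  show "pq_T (R_mat p q a (Suc n)) = tau_denom p q a (Suc n) 0 (R_mat p q (shift_seq 1 a) n)"
  proof (rule eq_matI)
    fix i j
    assume "i < dim_row (tau_denom p q a (Suc n) 0 (R_mat p q (shift_seq 1 a) n))"
      and "j < dim_col (tau_denom p q a (Suc n) 0 (R_mat p q (shift_seq 1 a) n))"
    then have ij: "i < q" "j < p"
      by (auto simp: tau_denom_def rho_plus_def rho_minus_def)
    then have ijN: "i < N" "j < N" using N by auto
    have "1 / W 0 0 = z_var - fls_const (a 0 0) - (\<Sum>l<q. u l * (\<Sum>m<p. S l m * v m))"
      using corner nz by (simp add: field_simps)
    \<comment> \<open>The correction term in \<open>W_block\<close> cancels against the product of
      the two border entries.\<close>
    moreover have "(W (Suc i) (Suc j) * W 0 0 - W 0 (Suc j) * W (Suc i) 0) / W 0 0 = S i j"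
      unfolding W_block[OF ijN] W_col[OF ijN(1)] using nz by (simp add: field_simps)
    moreover have "W (Suc i) 0 / W 0 0 = (\<Sum>l<p. S i l * v l)"
      unfolding W_col[OF ijN(1)] using nz by simp
    moreover have "W 0 (Suc j) / W 0 0 = (\<Sum>l<q. u l * S l j)"
      unfolding W_row[OF ijN(2)] using nz by simp
    ultimately show "pq_T (R_mat p q a (Suc n)) $$ (i, j) =
        tau_denom p q a (Suc n) 0 (R_mat p q (shift_seq 1 a) n) $$ (i, j)"
      unfolding T[OF ij] R_mat_def[of _ _ "shift_seq 1 a"] tau_denom_entry[OF ij]
      by (simp add: u_def v_def S_def)
  qed (auto simp: pq_T_def tau_denom_def rho_plus_def rho_minus_def R_dim Let_def)
qed

section \<open>The pseudo-quotient\<close>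

text \<open>The bottom right entry of \<open>pq_T A\<close> gives the corner of \<open>A\<close>;
  then its last row and column give the first row and column of \<open>A\<close>, and these give the
  rest.\<close>

lemma pq_T_inject:
  fixes A B :: "'a :: field mat"
  assumes "A \<in> carrier_mat q p" "B \<in> carrier_mat q p" and "q \<ge> 1" "p \<ge> 1"
    and A0: "A $$ (0, 0) \<noteq> 0" and B0: "B $$ (0, 0) \<noteq> 0" and eq: "pq_T A = pq_T B"
  shows "A = B"
proof (rule eq_matI)
  have dims: "dim_row A = q" "dim_col A = p" "dim_row B = q" "dim_col B = p"
    using assms by auto
  have nth: "pq_T A $$ (i, j) = pq_T B $$ (i, j)" for i j
    using eq by simp
  have c: "A $$ (0, 0) = B $$ (0, 0)"
    using nth[of "q - 1" "p - 1"] assms(3,4) A0 B0 by (simp add: pq_T_def dims Let_def)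
  have r: "A $$ (0, Suc j) = B $$ (0, Suc j)" if "Suc j < p" for j
    using nth[of "q - 1" j] assms(3,4) A0 B0 c that by (simp add: pq_T_def dims Let_def)
  have l: "A $$ (Suc i, 0) = B $$ (Suc i, 0)" if "Suc i < q" for i
    using nth[of i "p - 1"] assms(3,4) A0 B0 c that by (simp add: pq_T_def dims Let_def)
  have b: "A $$ (Suc i, Suc j) = B $$ (Suc i, Suc j)" if "Suc i < q" "Suc j < p" for i j
    using nth[of i j] assms(3,4) A0 B0 c r l that by (simp add: pq_T_def dims Let_def)
  show "A $$ (i, j) = B $$ (i, j)" if "i < dim_row B" "j < dim_col B" for i j
    using that c r l b by (cases i; cases j) (auto simp: dims)
qed (use assms in auto)

text \<open>\<open>A\<close> is itself a preimage with nonzero corner, and injectivity makes it the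
  one that \<open>THE\<close> selects.\<close>

lemma pseudo_recip_pq_T:
  assumes "A \<in> carrier_mat q p" and "q \<ge> 1" "p \<ge> 1" and "A $$ (0, 0) \<noteq> 0"
  shows "pseudo_recip (pq_T A) = A"
proof -
  have dims: "dim_row (pq_T A) = q" "dim_col (pq_T A) = p"
    using assms(1) by (auto simp: pq_T_def Let_def)
  show ?thesis
    unfolding pseudo_recip_def dims
    using assms pq_T_inject by (intro the_equality conjI) (auto dest: pq_T_inject)
qed

lemma pq_T_bottom_right:
  assumes "A \<in> carrier_mat q p" and "q \<ge> 1" "p \<ge> 1"
  shows "pq_T A $$ (q - 1, p - 1) = 1 / A $$ (0, 0)"
  using assms by (auto simp: pq_T_def Let_def)

section \<open>Iteration along the shifted sequences\<close>

lemma tau_denom_shift: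
  "k \<le> n \<Longrightarrow> tau_denom p q (shift_seq k a) (n - k) 0 X = tau_denom p q a n k X"
  by (simp add: tau_denom_def rho_def rho_plus_def rho_minus_def b_plus_def b_minus_def
      shift_seq_def less_diff_conv add.commute cong: if_cong)

text \<open>\<open>R_mat_step\<close> for the sequences shifted by \<open>k\<close> and size
  \<open>n - k\<close>. There the cutoff \<open>k + i < n\<close> reads \<open>i < n - k\<close>, so
  \<open>tau_denom_shift\<close> recovers step \<open>k\<close> of the original data.\<close>

lemma pq_T_R_mat_shift:
  assumes "p \<ge> 1" "q \<ge> 1" "k < n"
  shows "R_mat p q (shift_seq k a) (n - k) $$ (0, 0) \<noteq> 0"
    and "pq_T (R_mat p q (shift_seq k a) (n - k)) =
      tau_denom p q a n k (R_mat p q (shift_seq (Suc k) a) (n - Suc k))"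
proof -
  have n: "n - k = Suc (n - Suc k)" using assms by simp
  have s: "shift_seq 1 (shift_seq k a) = shift_seq (Suc k) a"
    by (intro ext) (simp add: shift_seq_def add_ac)
  show "R_mat p q (shift_seq k a) (n - k) $$ (0, 0) \<noteq> 0"
    unfolding n using assms by (intro R_mat_step)
  show "pq_T (R_mat p q (shift_seq k a) (n - k)) =
      tau_denom p q a n k (R_mat p q (shift_seq (Suc k) a) (n - Suc k))"
    using R_mat_step(2)[OF assms(1,2), of "shift_seq k a" "n - Suc k"]
      tau_denom_shift[of k n p q a] assms(3)
    unfolding s n[symmetric] by simp
qed

text \<open>Descending induction on \<open>k\<close>, from the innermost map outwards; each step
  undoes one \<open>pq_T\<close>.\<close>

lemma tau_tail_eq_R_mat:
  assumes "p \<ge> 1" "q \<ge> 1" "k \<le> n"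
  shows "tau_tail p q a n k (X_mat p q) = R_mat p q (shift_seq k a) (n - k)"
  using assms(3)
proof (induction rule: inc_induct)
  \<comment> \<open>At size \<open>0\<close> every index lies outside the block, so the prescribed
    values of \<open>R_entry\<close> form \<open>X_mat\<close>.\<close>
  case base
  show ?case
    by (simp add: tau_tail_def X_mat_def R_mat_def R_entry_def)
next
  case (step k)
  have "tau_tail p q a n k (X_mat p q) = tau_rho p q a n k (tau_tail p q a n (Suc k) (X_mat p q))"
    using step.hyps by (simp add: tau_tail_def upt_conv_Cons)
  also have "\<dots> = pseudo_recip (pq_T (R_mat p q (shift_seq k a) (n - k)))"
    unfolding step.IH tau_rho_def pq_T_R_mat_shift(2)[OF assms(1,2) step.hyps(2)] ..
  also have "\<dots> = R_mat p q (shift_seq k a) (n - k)"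
    using assms pq_T_R_mat_shift(1)[OF assms(1,2) step.hyps(2)]
    by (intro pseudo_recip_pq_T[of _ q p]) (auto simp: R_mat_def)
  finally show ?case .
qed

text \<open>The first conjunct ensures that every pseudo-quotient in the expansion is meaningful,
  since \<open>pseudo_recip\<close> is unspecified at a zero bottom right entry.\<close>

theorem proposition7p3:
  fixes p q n :: nat and a :: "int \<Rightarrow> int \<Rightarrow> complex"
  assumes "p \<ge> 1" and "q \<ge> 1" and "n \<ge> 1"
  shows "(\<forall>k<n. tau_denom p q a n k (tau_tail p q a n (k + 1) (X_mat p q)) $$ (q - 1, p - 1) \<noteq> 0)
    \<and> R_mat p q a n = tau_tail p q a n 0 (X_mat p q)"
proof (intro conjI allI impI)
  fix k assume k: "k < n"
  have "tau_denom p q a n k (tau_tail p q a n (k + 1) (X_mat p q)) =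
      pq_T (R_mat p q (shift_seq k a) (n - k))"
    using k by (simp add: tau_tail_eq_R_mat[OF assms(1,2)] pq_T_R_mat_shift(2)[OF assms(1,2)])
  moreover have "R_mat p q (shift_seq k a) (n - k) \<in> carrier_mat q p"
    by (simp add: R_mat_def)
  ultimately show "tau_denom p q a n k (tau_tail p q a n (k + 1) (X_mat p q)) $$ (q - 1, p - 1) \<noteq> 0"
    using pq_T_bottom_right[of "R_mat p q (shift_seq k a) (n - k)" q p] assms
      pq_T_R_mat_shift(1)[OF assms(1,2) k] by simp
next
  have "shift_seq 0 a = a"
    by (intro ext) (simp add: shift_seq_def)
  then show "R_mat p q a n = tau_tail p q a n 0 (X_mat p q)"
    by (simp add: tau_tail_eq_R_mat[OF assms(1,2)])
qed

end
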